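(* Set $N=1$ (one source $P$, one target $\mathcal D$). There exist distributions $P,\mathcal D$ on $\mathcal X\times\mathcal Y$ satisfying a Bernstein class condition with parameters $(C_\beta,\beta)$ for some $0\le\beta<1$, and sharing the same $h^*=h_P^*=h_{\mathcal D}^*$, such that the following holds. Consider a multisample $Z=\{Z_P,Z_{\mathcal D}\}$ consisting of independent datasets $Z_P\sim P^{n_P}$, $Z_{\mathcal D}\sim\mathcal D^{n_{\mathcal D}}$, and let $\hat h_Z,\hat h_{Z_P},\hat h_{Z_{\mathcal D}}$ denote the ERMs over $Z$ (i.e. over $Z_P\cup Z_{\mathcal D}$), $Z_P$, $Z_{\mathcal D}$ respectively. Suppose $1\le n_{\mathcal D}^2\le\frac18 n_P^{(2-2\beta)/(2-\beta)}$. Then $$\min\big\{\mathbb E[\mathcal E_{\mathcal D}(\hat h_{Z_P})],\ \mathbb E[\mathcal E_{\mathcal D}(\hat h_Z)]\big\}\ge\tfrac14,\quad\text{while}\quad \mathbb E[\mathcal E_{\mathcal D}(\hat h_{Z_{\mathcal D}})]\lesssim n_{\mathcal D}^{-1/(2-\beta)};$$ however, $$\max\big\{\mathbb E[\mathcal E_P(\hat h_{Z_P})],\ \mathbb E[\mathcal E_P(\hat h_Z)]\big\}\lesssim n_P^{-1/(2-\beta)}.$$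
   Context: $\mathcal X$ is an instance space, $\mathcal Y=\{-1,1\}$, and $\mathcal H$ is a fixed class of classifiers $h:\mathcal X\to\mathcal Y$ with finite VC dimension $d_{\mathcal H}$ and $|\mathcal H|\ge3$. For a distribution $P$ on $\mathcal X\times\mathcal Y$: $R_P(h)=P(h(X)\neq Y)$, $\mathcal E_P(h)=R_P(h)-\inf_{h'\in\mathcal H}R_P(h')$, $P(h\neq h')=P_X(h(X)\ne h'(X))$, $h^*_P\in\arg\min_{h\in\mathcal H}R_P(h)$. $P$ satisfies a Bernstein class condition with parameters $(C_\beta,\beta)$, $\beta\in[0,1]$, $C_\beta\ge2$, if $P(h\ne h_P^* )\le C_\beta\,\mathcal E_P^\beta(h)$ for all $h\in\mathcal H$ (always true for $\beta=0$). An ERM over a dataset $S$ is an element of $\arg\min_{h\in\mathcal H}\frac1{|S|}\sum_{(x,y)\in S}\mathbf 1\{h(x)\ne y\}$. The notation $a\lesssim b$ means inequality up to constants (which may depend on $C_\beta$ and $d_{\mathcal H}$) and factors logarithmic in the sample sizes. *)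

theory Defs
  imports "HOL-Probability.Probability"
begin

type_synonym 'x classifier = "'x \<Rightarrow> int"
type_synonym 'x dataset = "('x \<times> int) list"

abbreviation labels :: "int set" where
  "labels \<equiv> {-1, 1}"

text \<open>
  The instance space is the type \<open>'x\<close> with its discrete sigma-algebra, so that every classifier,
  every learner and every expectation below is measurable; distributions are \<open>pmf\<close>s.
\<close>

definition distribution_on_labels :: "('x \<times> int) pmf \<Rightarrow> bool" where
  "distribution_on_labels P \<longleftrightarrow> set_pmf P \<subseteq> UNIV \<times> labels"

definition shatters :: "'x classifier set \<Rightarrow> 'x set \<Rightarrow> bool" where
  "shatters H A \<longleftrightarrow> (\<forall>f \<in> A \<rightarrow> labels. \<exists>h\<in>H. \<forall>x\<in>A. h x = f x)"

definition has_vc_dim :: "'x classifier set \<Rightarrow> nat \<Rightarrow> bool" where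
  "has_vc_dim H d \<longleftrightarrow>
     (\<exists>A. finite A \<and> card A = d \<and> shatters H A) \<and>
     (\<forall>A. finite A \<and> shatters H A \<longrightarrow> card A \<le> d)"

text \<open>\<open>card\<close> is 0 on infinite sets, whence the disjunction.\<close>

definition hypothesis_class :: "'x classifier set \<Rightarrow> nat \<Rightarrow> bool" where
  "hypothesis_class H d \<longleftrightarrow>
     H \<subseteq> UNIV \<rightarrow> labels \<and> has_vc_dim H d \<and> (infinite H \<or> 3 \<le> card H)"

definition risk :: "('x \<times> int) pmf \<Rightarrow> 'x classifier \<Rightarrow> real" where
  "risk P h = measure_pmf.prob P {(x, y). h x \<noteq> y}"

definition excess_risk :: "'x classifier set \<Rightarrow> ('x \<times> int) pmf \<Rightarrow> 'x classifier \<Rightarrow> real" where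
  "excess_risk H P h = risk P h - (INF h'\<in>H. risk P h')"

definition disagreement :: "('x \<times> int) pmf \<Rightarrow> 'x classifier \<Rightarrow> 'x classifier \<Rightarrow> real" where
  "disagreement P h h' = measure_pmf.prob (map_pmf fst P) {x. h x \<noteq> h' x}"

text \<open>
  The case distinction implements \<open>0\<^sup>0 = 1\<close> (in the library \<open>0 powr 0 = 0\<close>), so that the condition
  always holds for \<open>\<beta> = 0\<close>.
\<close>

definition bernstein_class ::
  "'x classifier set \<Rightarrow> ('x \<times> int) pmf \<Rightarrow> 'x classifier \<Rightarrow> real \<Rightarrow> real \<Rightarrow> bool" where
  "bernstein_class H P hs C \<beta> \<longleftrightarrow>
     2 \<le> C \<and> 0 \<le> \<beta> \<and> \<beta> \<le> 1 \<and> is_arg_min (risk P) (\<lambda>h. h \<in> H) hs \<and>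
     (\<forall>h\<in>H. disagreement P h hs \<le> C * (if \<beta> = 0 then 1 else excess_risk H P h powr \<beta>))"

definition emp_risk :: "'x dataset \<Rightarrow> 'x classifier \<Rightarrow> real" where
  "emp_risk S h = (\<Sum>(x, y)\<leftarrow>S. of_bool (h x \<noteq> y)) / real (length S)"

definition is_erm :: "'x classifier set \<Rightarrow> 'x dataset \<Rightarrow> 'x classifier \<Rightarrow> bool" where
  "is_erm H S h \<longleftrightarrow> is_arg_min (emp_risk S) (\<lambda>h. h \<in> H) h"

text \<open>Inequality up to the constant \<open>K\<close> and a polylogarithmic factor in the sample size \<open>n\<close>.\<close>

definition le_upto_log :: "real \<Rightarrow> nat \<Rightarrow> nat \<Rightarrow> real \<Rightarrow> real \<Rightarrow> bool" where
  "le_upto_log K k n a b \<longleftrightarrow> a \<le> K * (1 + ln (real n)) ^ k * b"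

text \<open>
  The source and the target are both label distributions satisfying the Bernstein class condition,
  with the common risk minimizer \<open>hs\<close>.
\<close>

definition source_target ::
  "'x classifier set \<Rightarrow> real \<Rightarrow> real \<Rightarrow> 'x classifier \<Rightarrow> ('x \<times> int) pmf \<Rightarrow> ('x \<times> int) pmf \<Rightarrow> bool" where
  "source_target H C \<beta> hs P D \<longleftrightarrow>
     distribution_on_labels P \<and> distribution_on_labels D \<and>
     bernstein_class H P hs C \<beta> \<and> bernstein_class H D hs C \<beta>"

text \<open>
  The bounds hold for every choice of the empirical risk minimizers \<open>hP\<close>, \<open>hD\<close>, \<open>hZ\<close> on the source
  sample, the target sample and their union (with multiplicities), as functions of the samples.
\<close>

definition erm_bounds ::
  "'x classifier set \<Rightarrow> real \<Rightarrow> real \<Rightarrow> nat \<Rightarrow>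
     ('x \<times> int) pmf \<Rightarrow> ('x \<times> int) pmf \<Rightarrow> nat \<Rightarrow> nat \<Rightarrow> bool" where
  "erm_bounds H \<beta> K k P D nP nD \<longleftrightarrow>
     (\<forall>(hP :: 'x dataset \<Rightarrow> 'x classifier) (hD :: 'x dataset \<Rightarrow> 'x classifier)
        (hZ :: 'x dataset \<times> 'x dataset \<Rightarrow> 'x classifier).
        (\<forall>S. is_erm H S (hP S)) \<and> (\<forall>S. is_erm H S (hD S)) \<and>
        (\<forall>S T. is_erm H (S @ T) (hZ (S, T))) \<longrightarrow>
        (let ZP = replicate_pmf nP P; ZD = replicate_pmf nD D; Z = pair_pmf ZP ZD in
          min (measure_pmf.expectation ZP (\<lambda>S. excess_risk H D (hP S)))
              (measure_pmf.expectation Z (\<lambda>S. excess_risk H D (hZ S))) \<ge> 1 / 4 \<and>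
          le_upto_log K k nD
            (measure_pmf.expectation ZD (\<lambda>S. excess_risk H D (hD S)))
            (real nD powr (- 1 / (2 - \<beta>))) \<and>
          le_upto_log K k nP
            (max (measure_pmf.expectation ZP (\<lambda>S. excess_risk H P (hP S)))
                 (measure_pmf.expectation Z (\<lambda>S. excess_risk H P (hZ S))))
            (real nP powr (- 1 / (2 - \<beta>)))))"

definition sample_sizes_ok :: "real \<Rightarrow> nat \<Rightarrow> nat \<Rightarrow> bool" where
  "sample_sizes_ok \<beta> nP nD \<longleftrightarrow>
     1 \<le> (real nD)\<^sup>2 \<and> (real nD)\<^sup>2 \<le> 1 / 8 * real nP powr ((2 - 2 * \<beta>) / (2 - \<beta>))"

end

(* Since H has three elements, two of its classifiers hs and h' agree at some x0 and differ at some
   x1. The target is the point mass at (x1, hs x1), so that a single target observation identifies hs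
   at x1 and predicting h' there costs 1. The source puts mass p on x1, with label hs x1 of
   probability (1 + b) / 2 only, and the rest on the noiseless point (x0, hs x0); h' then has source
   excess risk p b. The parameters p b = n^(-1/(2-beta)) / 400 and p = min 1 (4 n^(-beta/(2-beta)))
   obey the Bernstein condition, while the vote of the source labels at x1 has variance n p and mean
   -n p b, which is small compared to the standard deviation. With probability at least 1/4 the wrong
   source labels therefore outnumber the right ones by more than n_D, and the target sample cannot
   correct the ERM. For b = 0 this is anti-concentration of a lazy random walk, by the size of the
   central binomial coefficient; the bias costs at most a chi-square distance. *)
theory Submission
  imports Defs
begin

section \<open>Anti-concentration of a fair vote\<close>

text \<open>The factor \<open>3 * j + 1\<close> makes the induction close: the ratio of consecutive
  coefficients is \<open>2 * (2 * j + 1) / (j + 1)\<close>, and the step reduces to \<open>(2 * j +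
  1)^2 * (3 * j + 4) \<le> 4 * (j + 1)^2 * (3 * j + 1)\<close>, whose sides differ by
  \<open>j\<close>.\<close>

lemma central_binomial_bound: "((2 * j) choose j)^2 * (3 * j + 1) \<le> (16::nat) ^ j"
proof (induction j)
  case 0
  show ?case by simp
next
  case (Suc j)
  have rec: "(j + 1) * ((2 * Suc j) choose Suc j) = 2 * (2 * j + 1) * ((2 * j) choose j)"
  proof -
    define A B where "A = (Suc (Suc (2 * j)) choose Suc j)" and "B = (Suc (2 * j) choose j)"
    have 1: "Suc j * A = Suc (Suc (2 * j)) * B"
      unfolding A_def B_def by (rule Suc_times_binomial)
    have "B = (Suc (2 * j) choose Suc j)"
      unfolding B_def by (subst binomial_symmetric) auto
    then have 2: "Suc j * B = Suc (2 * j) * ((2 * j) choose j)"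
      by (simp only: Suc_times_binomial)
    have "Suc j * (Suc j * A) = Suc j * (2 * Suc (2 * j) * ((2 * j) choose j))"
      unfolding 1 using arg_cong[OF 2, of "\<lambda>x. 2 * Suc j * x"]
      by (simp del: binomial_Suc_Suc add: algebra_simps)
    then have "Suc j * A = 2 * Suc (2 * j) * ((2 * j) choose j)"
      by (subst (asm) mult_left_cancel) auto
    then show ?thesis by (simp add: A_def del: binomial_Suc_Suc)
  qed
  have "((j + 1)^2 * (3 * j + 1)) * (((2 * Suc j) choose Suc j)^2 * (3 * Suc j + 1))
      = ((j + 1) * ((2 * Suc j) choose Suc j))^2 * (3 * j + 1) * (3 * j + 4)"
    by (simp add: power2_eq_square algebra_simps del: binomial_Suc_Suc)
  also have "\<dots> = (((2 * j) choose j)^2 * (3 * j + 1)) * (4 * (2 * j + 1)^2 * (3 * j + 4))"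
    unfolding rec by (simp add: power2_eq_square algebra_simps)
  also have "\<dots> \<le> 16 ^ j * (16 * ((j + 1)^2 * (3 * j + 1)))"
    by (rule mult_le_mono[OF Suc.IH]) (simp add: power2_eq_square algebra_simps)
  finally have "((j + 1)^2 * (3 * j + 1)) * (((2 * Suc j) choose Suc j)^2 * (3 * Suc j + 1))
      \<le> ((j + 1)^2 * (3 * j + 1)) * 16 ^ Suc j" by (simp only: power_Suc mult_ac)
  then show ?case by (rule mult_left_le_imp_le) simp
qed

text \<open>For odd \<open>m\<close> the middle coefficient is half of the next central one;
  \<open>3 * m + 2\<close> is a factor that serves both parities.\<close>

lemma middle_binomial_bound: "(m choose (m div 2))^2 * (3 * m + 2) \<le> 2 * (4::nat) ^ m"
proof (cases "even m")
  case True
  then obtain j where m: "m = 2 * j" by auto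
  have "((2 * j) choose j)^2 * (3 * j + 1) * 2 \<le> 16 ^ j * 2"
    using central_binomial_bound[of j] by simp
  moreover have "(16::nat) ^ j = 4 ^ m" by (simp add: m power_mult)
  ultimately show ?thesis by (simp add: m algebra_simps)
next
  case False
  then obtain j where m: "m = 2 * j + 1" by (auto elim: oddE)
  define c where "c = (Suc (2 * j) choose j)"
  have "(2 * Suc j) choose Suc j = 2 * c"
    using binomial_symmetric[of j "Suc (2 * j)"] by (simp add: c_def)
  with central_binomial_bound[of "Suc j"] have "(2 * c)^2 * (3 * Suc j + 1) \<le> 16 ^ Suc j"
    by (simp only:)
  then have "c^2 * (3 * j + 4) \<le> 4 * 16 ^ j"
    by (simp add: power2_eq_square algebra_simps)
  then have "c^2 * (6 * j + 8) \<le> 8 * 16 ^ j" by (simp add: algebra_simps)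
  moreover have "c^2 * (6 * j + 5) \<le> c^2 * (6 * j + 8)" by simp
  ultimately have "c^2 * (6 * j + 5) \<le> 8 * 16 ^ j" by (rule le_trans[rotated])
  moreover have "8 * (16::nat) ^ j = 2 * 4 ^ m" by (simp add: m power_mult)
  moreover have "m choose (m div 2) = c" "3 * m + 2 = 6 * j + 5" by (simp_all add: m c_def)
  ultimately show ?thesis by (simp only:)
qed

text \<open>The reflection \<open>m - j\<close> gives both tails the same weight, and the window
  between them has at most \<open>k + 1\<close> indices, each contributing at most the middle
  coefficient.\<close>

lemma binomial_upper_tail:
  "2 ^ m \<le> 2 * (\<Sum>j | j \<le> m \<and> m + k < 2 * j. m choose j) + (k + 1) * (m choose (m div 2))"
proof -
  let ?U = "{j. j \<le> m \<and> m + k < 2 * j}" and ?L = "{j. j \<le> m \<and> 2 * j + k < m}"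
    and ?M = "{j. j \<le> m \<and> m \<le> 2 * j + k \<and> 2 * j \<le> m + k}"
  have fin: "finite ?U" "finite ?L" "finite ?M" by auto
  have "(2::nat) ^ m = (\<Sum>j\<le>m. m choose j)" by (rule choose_row_sum[symmetric])
  also have "{..m} = ?U \<union> ?L \<union> ?M" by auto
  also have "(\<Sum>j\<in>?U \<union> ?L \<union> ?M. m choose j) =
      (\<Sum>j\<in>?U. m choose j) + (\<Sum>j\<in>?L. m choose j) + (\<Sum>j\<in>?M. m choose j)"
    using fin by (subst sum.union_disjoint; auto)+
  also have "(\<Sum>j\<in>?L. m choose j) = (\<Sum>j\<in>?U. m choose j)"
    by (rule sum.reindex_bij_witness[of _ "\<lambda>j. m - j" "\<lambda>j. m - j"])
       (auto simp: binomial_symmetric[symmetric])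
  finally have total: "2 ^ m = 2 * (\<Sum>j\<in>?U. m choose j) + (\<Sum>j\<in>?M. m choose j)" by simp
  \<comment> \<open>The lower end is \<open>(m - k) / 2\<close> rounded up; for \<open>k > m\<close>
    truncated subtraction makes it 0, as it should be.\<close>
  have "?M \<subseteq> {(m - k + 1) div 2..(m + k) div 2}"
  proof
    fix j assume "j \<in> ?M"
    then have "m \<le> 2 * j + k" "2 * j \<le> m + k" by blast+
    then have "(m - k + 1) div 2 \<le> j" "j \<le> (m + k) div 2" by linarith+
    then show "j \<in> {(m - k + 1) div 2..(m + k) div 2}" by simp
  qed
  then have "card ?M \<le> card {(m - k + 1) div 2..(m + k) div 2}" by (intro card_mono) auto
  moreover have "Suc ((m + k) div 2) - (m - k + 1) div 2 \<le> k + 1" by linarith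
  ultimately have "card ?M \<le> k + 1" by simp
  then have "card ?M * (m choose (m div 2)) \<le> (k + 1) * (m choose (m div 2))"
    by (rule mult_le_mono1)
  moreover have "(\<Sum>j\<in>?M. m choose j) \<le> card ?M * (m choose (m div 2))"
    using sum_bounded_above[of ?M "\<lambda>j. m choose j" "m choose (m div 2)"]
    by (simp add: binomial_maximum)
  ultimately show ?thesis using total by linarith
qed

lemma prob_fair_binomial:
  "measure_pmf.prob (binomial_pmf m (1/2)) {j. m + k < 2 * j}
    = real (\<Sum>j | j \<le> m \<and> m + k < 2 * j. m choose j) / 2 ^ m"
proof -
  let ?A = "{j. j \<le> m \<and> m + k < 2 * j}"
  have "measure_pmf.prob (binomial_pmf m (1/2)) {j. m + k < 2 * j}
      = measure_pmf.prob (binomial_pmf m (1/2)) ?A"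
    by (intro measure_prob_cong_0) auto
  also have "\<dots> = (\<Sum>j\<in>?A. pmf (binomial_pmf m (1/2)) j)"
    by (intro measure_measure_pmf_finite) auto
  also have "\<dots> = (\<Sum>j\<in>?A. real (m choose j) / 2 ^ m)"
    by (intro sum.cong refl) (auto simp: field_simps simp flip: power_add)
  finally show ?thesis by (simp add: sum_divide_distrib)
qed

lemma prob_fair_binomial_ge:
  "measure_pmf.prob (binomial_pmf m (1/2)) {j. m + k < 2 * j}
    \<ge> (1 - real (k + 1) * (real (m choose (m div 2)) / 2 ^ m)) / 2"
proof -
  have "real (2 ^ m) \<le> real (2 * (\<Sum>j | j \<le> m \<and> m + k < 2 * j. m choose j)
      + (k + 1) * (m choose (m div 2)))"
    using binomial_upper_tail by (simp only: of_nat_le_iff)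
  then have "2 ^ m \<le> 2 * real (\<Sum>j | j \<le> m \<and> m + k < 2 * j. m choose j)
      + real (k + 1) * real (m choose (m div 2))"
    by (simp only: of_nat_add of_nat_mult of_nat_power of_nat_numeral)
  then have "2 ^ m / 2 ^ m \<le> (2 * real (\<Sum>j | j \<le> m \<and> m + k < 2 * j. m choose j)
      + real (k + 1) * real (m choose (m div 2))) / 2 ^ m"
    by (rule divide_right_mono) simp
  then have "1 \<le> 2 * (real (\<Sum>j | j \<le> m \<and> m + k < 2 * j. m choose j) / 2 ^ m)
      + real (k + 1) * (real (m choose (m div 2)) / 2 ^ m)"
    by (simp only: add_divide_distrib times_divide_eq_right) simp
  moreover have "(1 - x) / 2 \<le> y" if "1 \<le> 2 * y + x" for x y :: real
    using that by simp
  ultimately show ?thesis unfolding prob_fair_binomial by blast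
qed

lemma middle_atom_sq: "(real (m choose (m div 2)) / 2 ^ m)^2 \<le> 2 / (3 * real m + 2)"
proof -
  have "real ((m choose (m div 2))^2 * (3 * m + 2)) \<le> real (2 * 4 ^ m)"
    using middle_binomial_bound by (simp only: of_nat_le_iff)
  moreover have "(2 ^ m)\<^sup>2 = (4::real) ^ m" by (simp add: power2_eq_square flip: power_mult_distrib)
  ultimately show ?thesis by (simp add: power_divide field_simps)
qed

text \<open>
  For \<open>k = 1\<close> the smallest sample sizes need exact values: at \<open>n = 9\<close> the probability is
  \<open>65 / 256\<close> exactly, which leaves a slack of \<open>1 / 256\<close> for the bias of the labels.
\<close>

lemma fair_deterministic_votes:
  assumes "1 \<le> k" "8 * k^2 \<le> n"
  shows "measure_pmf.prob (binomial_pmf n (1/2)) {j. n + k < 2 * j} \<ge> 65 / 256"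
proof -
  consider "n = 8" "k = 1" | "n = 9" "k = 1" | "n = 10" "k = 1" | "11 \<le> n" "k = 1" | "2 \<le> k"
  proof -
    have "8 \<le> n" if "k = 1" using assms that by simp
    then show ?thesis using assms that by linarith
  qed
  then show ?thesis
  proof cases
    case 1
    \<comment> \<open>The general estimate would give only 58 / 256 here, so the four terms are
      summed directly.\<close>
    have "{j. j \<le> 8 \<and> 8 + 1 < 2 * j} = {5, 6, 7, 8::nat}" by auto
    moreover have "(8 choose 5) = (56::nat)" "(8 choose 6) = (28::nat)" "(8 choose 7) = (8::nat)"
      by (simp_all add: binomial_fact' fact_numeral)
    ultimately show ?thesis unfolding 1 prob_fair_binomial by simp
  next
    case 2
    have "(9 choose 4) = (126::nat)" by (simp add: binomial_fact' fact_numeral)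
    then show ?thesis using prob_fair_binomial_ge[of k n] by (simp add: 2)
  next
    case 3
    have "(10 choose 5) = (252::nat)" by (simp add: binomial_fact' fact_numeral)
    then show ?thesis using prob_fair_binomial_ge[of k n] by (simp add: 3)
  next
    case 4
    define a where "a = real (n choose (n div 2)) / 2 ^ n"
    \<comment> \<open>The required 65 / 256 follows from \<open>a \<le> 63 / 256\<close>, and
      \<open>2 / (3 * n + 2)\<close> falls below the square of 63 / 256 only from
      \<open>n = 11\<close> on.\<close>
    have "2 / (3 * real n + 2) \<le> 2 / 35" using 4 by (intro divide_left_mono) auto
    then have "a^2 \<le> (63 / 256)^2"
      using middle_atom_sq[of n] by (simp add: a_def power2_eq_square)
    then have "a \<le> 63 / 256" by (rule power2_le_imp_le) simp
    then show ?thesis using prob_fair_binomial_ge[of k n] 4 by (simp add: a_def)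
  next
    case 5
    define a where "a = real (n choose (n div 2)) / 2 ^ n"
    have n: "8 * (real k)^2 \<le> real n"
      using assms(2) by (metis of_nat_mult of_nat_le_iff of_nat_power of_nat_numeral)
    have "(real (k + 1) * a)^2 \<le> (real (k + 1))^2 * (2 / (3 * real n + 2))"
      unfolding a_def power_mult_distrib by (intro mult_left_mono middle_atom_sq) auto
    also have "\<dots> \<le> (real (k + 1))^2 * (2 / (24 * (real k)^2 + 2))"
      using n by (intro mult_left_mono divide_left_mono mult_pos_pos add_nonneg_pos) auto
    also have "\<dots> \<le> (63 / 128)^2"
    proof -
      \<comment> \<open>This absorbs the linear term of \<open>(k + 1)^2\<close>; the integers below
        are \<open>2 * 128^2\<close> and \<open>63^2\<close>.\<close>
      have "2 * real k \<le> (real k)^2" using 5 by (simp add: power2_eq_square)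
      then have "32768 * (real (k + 1))^2 \<le> 3969 * (24 * (real k)^2 + 2)"
        using 5 by (simp add: power2_sum)
      moreover have "24 * (real k)^2 + 2 > 0" by (simp add: add_nonneg_pos)
      ultimately show ?thesis by (simp add: field_simps power_divide)
    qed
    finally have "real (k + 1) * a \<le> 63 / 128" by (rule power2_le_imp_le) simp
    then show ?thesis using prob_fair_binomial_ge[of k n] by (simp add: a_def)
  qed
qed

section \<open>Change of measure for samples\<close>

lemma expectation_bind_finite:
  fixes h :: "'b \<Rightarrow> real"
  assumes "finite (set_pmf p)" "\<And>x. x \<in> set_pmf p \<Longrightarrow> finite (set_pmf (f x))"
  shows "measure_pmf.expectation (bind_pmf p f) h
    = measure_pmf.expectation p (\<lambda>x. measure_pmf.expectation (f x) h)"
  using assms by (simp add: pmf_expectation_bind[where A = "set_pmf p"]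
      integral_measure_pmf[where A = "set_pmf p"])

lemma finite_set_replicate_pmf: "finite (set_pmf P) \<Longrightarrow> finite (set_pmf (replicate_pmf n P))"
  by (simp add: set_replicate_pmf lists_eq_set finite_lists_length_eq)

lemma expectation_replicate_Suc:
  fixes F :: "'a list \<Rightarrow> real"
  assumes "finite (set_pmf P)"
  shows "measure_pmf.expectation (replicate_pmf (Suc n) P) F
    = measure_pmf.expectation P (\<lambda>x. measure_pmf.expectation (replicate_pmf n P) (\<lambda>S. F (x # S)))"
  using assms by (simp add: expectation_bind_finite finite_set_replicate_pmf)

lemma expectation_replicate_prod:
  fixes f :: "'a \<Rightarrow> real"
  assumes "finite (set_pmf P)"
  shows "measure_pmf.expectation (replicate_pmf n P) (\<lambda>S. \<Prod>x\<leftarrow>S. f x)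
    = measure_pmf.expectation P f ^ n"
  by (induction n) (simp_all add: expectation_replicate_Suc assms del: replicate_pmf.simps(2))

text \<open>The likelihood ratio of a product measure is the product of the ratios. The density
  \<open>L\<close> enters through test functions, so that no probabilities are divided.\<close>

lemma expectation_replicate_density:
  fixes F :: "'a list \<Rightarrow> real"
  assumes fin: "finite (set_pmf P)" "finite (set_pmf Q)"
    and dens: "\<And>f :: 'a \<Rightarrow> real.
      measure_pmf.expectation Q f = measure_pmf.expectation P (\<lambda>x. L x * f x)"
  shows "measure_pmf.expectation (replicate_pmf n Q) F
    = measure_pmf.expectation (replicate_pmf n P) (\<lambda>S. (\<Prod>x\<leftarrow>S. L x) * F S)"
proof (induction n arbitrary: F)
  case 0
  show ?case by simp
next
  case (Suc n)
  show ?case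
    by (simp add: expectation_replicate_Suc fin dens Suc.IH mult.assoc del: replicate_pmf.simps(2))
qed

lemma expectation_sq_le:
  fixes X :: "'a \<Rightarrow> real"
  assumes "finite (set_pmf P)"
  shows "(measure_pmf.expectation P X)^2 \<le> measure_pmf.expectation P (\<lambda>x. (X x)^2)"
  using measure_pmf.variance_positive[of P X] assms
  by (simp add: measure_pmf.variance_eq integrable_measure_pmf_finite)

text \<open>The loss of probability is the mean of \<open>1 - \<Lambda>\<close> on the event, where
  \<open>\<Lambda>\<close> is the likelihood ratio of the samples. By Jensen it is at most the
  square root of the mean of \<open>(1 - \<Lambda>)^2\<close>, the chi-square divergence;
  independence turns the second moment of \<open>\<Lambda>\<close> into a power.\<close>

lemma prob_replicate_change_of_measure:
  assumes fin: "finite (set_pmf P)" "finite (set_pmf Q)"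
    and dens: "\<And>f :: 'a \<Rightarrow> real.
      measure_pmf.expectation Q f = measure_pmf.expectation P (\<lambda>x. L x * f x)"
  shows "measure_pmf.prob (replicate_pmf n P) A
      - sqrt (measure_pmf.expectation P (\<lambda>x. (L x)^2) ^ n - 1)
    \<le> measure_pmf.prob (replicate_pmf n Q) A"
proof -
  let ?R = "replicate_pmf n P"
  define \<Lambda> where "\<Lambda> S = (\<Prod>x\<leftarrow>S. L x)" for S
  have int: "integrable (measure_pmf ?R) f" for f :: "'a list \<Rightarrow> real"
    by (intro integrable_measure_pmf_finite finite_set_replicate_pmf fin)
  have sq: "(\<Lambda> S)^2 = (\<Prod>x\<leftarrow>S. (L x)^2)" for S
    unfolding \<Lambda>_def by (induction S) (simp_all add: power_mult_distrib)
  have E2: "measure_pmf.expectation ?R (\<lambda>S. (\<Lambda> S)^2) = measure_pmf.expectation P (\<lambda>x. (L x)^2) ^ n"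
    unfolding sq by (rule expectation_replicate_prod[OF fin(1)])
  have "measure_pmf.expectation P L = 1" using dens[of "\<lambda>_. 1"] by simp
  then have E1: "measure_pmf.expectation ?R \<Lambda> = 1"
    unfolding \<Lambda>_def by (simp add: expectation_replicate_prod[OF fin(1)])
  have PA: "measure_pmf.prob ?R A = measure_pmf.expectation ?R (indicator A)" by simp
  have "measure_pmf.prob (replicate_pmf n Q) A
      = measure_pmf.expectation (replicate_pmf n Q) (indicator A)" by simp
  also have "\<dots> = measure_pmf.expectation ?R (\<lambda>S. \<Lambda> S * indicator A S)"
    unfolding \<Lambda>_def by (rule expectation_replicate_density[OF fin dens])
  finally have QA: "measure_pmf.prob (replicate_pmf n Q) A
      = measure_pmf.expectation ?R (\<lambda>S. \<Lambda> S * indicator A S)" .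
  have "measure_pmf.prob ?R A - measure_pmf.prob (replicate_pmf n Q) A
      = measure_pmf.expectation ?R (\<lambda>S. (1 - \<Lambda> S) * indicator A S)"
    unfolding PA QA using int by (simp add: left_diff_distrib)
  also have "\<dots> \<le> sqrt (measure_pmf.expectation ?R (\<lambda>S. ((1 - \<Lambda> S) * indicator A S)^2))"
    using expectation_sq_le[OF finite_set_replicate_pmf[OF fin(1)]] by (intro real_le_rsqrt)
  also have "\<dots> \<le> sqrt (measure_pmf.expectation ?R (\<lambda>S. (1 - \<Lambda> S)^2))"
    using int by (intro real_sqrt_le_mono integral_mono) (auto simp: indicator_def)
  also have "measure_pmf.expectation ?R (\<lambda>S. (1 - \<Lambda> S)^2)
      = measure_pmf.expectation P (\<lambda>x. (L x)^2) ^ n - 1"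
    using int E1 E2 by (simp add: power2_diff)
  finally show ?thesis by simp
qed

section \<open>Fair votes with a random number of informative labels\<close>

text \<open>Absorption turns \<open>(n choose m) / (m + 1)\<close> into
  \<open>(n + 1 choose m + 1) / (n + 1)\<close>; what remains is the total mass of a binomial
  distribution with \<open>n + 1\<close> trials, without its term at 0.\<close>

lemma expectation_inverse_binomial:
  assumes "0 < p" "p \<le> 1"
  shows "measure_pmf.expectation (binomial_pmf n p) (\<lambda>m. 1 / (real m + 1)) \<le> 1 / (real (n + 1) * p)"
proof -
  have "real (n + 1) * p * measure_pmf.expectation (binomial_pmf n p) (\<lambda>m. 1 / (real m + 1))
      = (\<Sum>m\<le>n. real (n + 1) * p * (real (n choose m) * p ^ m * (1 - p) ^ (n - m) / (real m + 1)))"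
    using assms by (subst expectation_binomial_pmf') (auto simp: sum_distrib_left)
  also have "\<dots> = (\<Sum>m\<le>n. real (Suc n choose Suc m) * p ^ Suc m * (1 - p) ^ (Suc n - Suc m))"
  proof (intro sum.cong refl)
    fix m
    have "real (Suc m) * real (Suc n choose Suc m) = real (Suc n) * real (n choose m)"
      by (simp only: Suc_times_binomial flip: of_nat_mult)
    then have "real (Suc n choose Suc m) = real (n + 1) * real (n choose m) / (real m + 1)"
      by (simp add: field_simps del: binomial_Suc_Suc)
    then show "real (n + 1) * p * (real (n choose m) * p ^ m * (1 - p) ^ (n - m) / (real m + 1))
        = real (Suc n choose Suc m) * p ^ Suc m * (1 - p) ^ (Suc n - Suc m)"
      by (simp del: binomial_Suc_Suc)
  qed
  also have "\<dots> \<le> (\<Sum>m\<le>Suc n. real (Suc n choose m) * p ^ m * (1 - p) ^ (Suc n - m))"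
    using assms unfolding sum.atMost_Suc_shift by simp
  also have "\<dots> = 1" using binomial_ring[of p "1 - p" "Suc n"] by (simp del: sum.atMost_Suc binomial_Suc_Suc)
  finally have "real (n + 1) * p * measure_pmf.expectation (binomial_pmf n p) (\<lambda>m. 1 / (real m + 1)) \<le> 1" .
  moreover have "real (n + 1) * p > 0" using assms by simp
  ultimately show ?thesis by (subst pos_le_divide_eq) (simp_all only: mult.commute)
qed

lemma fair_random_votes:
  assumes p: "0 < p" "p \<le> 1" and k: "1 \<le> k" "32 * (real k)^2 \<le> real n * p"
  shows "measure_pmf.expectation (binomial_pmf n p)
    (\<lambda>m. measure_pmf.prob (binomial_pmf m (1/2)) {j. m + k < 2 * j}) \<ge> 65 / 256"
proof -
  have fin: "finite (set_pmf (binomial_pmf n p))" using p by (simp add: set_pmf_binomial_eq)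
  \<comment> \<open>AM-GM gives \<open>2 k a \<le> 6 k\<^sup>2 a\<^sup>2 + 1 / 6\<close> for the middle atom \<open>a\<close>; the expectation of its square is
    controlled by that of \<open>1 / (m + 1)\<close>, which has a closed form.\<close>
  have ptw: "5 / 12 - 3 * (real k)^2 * (1 / (real m + 1))
      \<le> measure_pmf.prob (binomial_pmf m (1/2)) {j. m + k < 2 * j}" for m
  proof -
    define a where "a = real (m choose (m div 2)) / 2 ^ m"
    have "a^2 \<le> 2 / (3 * real m + 2)" unfolding a_def by (rule middle_atom_sq)
    also have "\<dots> \<le> 1 / (real m + 1)" by (simp add: field_simps)
    finally have a2: "6 * (real k)^2 * a^2 \<le> 6 * (real k)^2 * (1 / (real m + 1))"
      by (intro mult_left_mono) auto
    have "a \<ge> 0" by (simp add: a_def)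
    then have "real (k + 1) * a \<le> 2 * real k * a" using k by (intro mult_right_mono) auto
    also have "\<dots> \<le> 6 * (real k)^2 * a^2 + 1 / 6"
      using zero_le_power2[of "6 * real k * a - 1"] by (simp add: power2_eq_square algebra_simps)
    finally show ?thesis
      using prob_fair_binomial_ge[of k m] a2 unfolding a_def[symmetric] by argo
  qed
  have "32 * (real k)^2 \<le> real (n + 1) * p" using p k by (simp add: algebra_simps)
  moreover have "real (n + 1) * p > 0" using p by simp
  ultimately have "(real k)^2 / (real (n + 1) * p) \<le> 1 / 32" by (simp add: pos_divide_le_eq)
  moreover have "3 * (real k)^2 * measure_pmf.expectation (binomial_pmf n p) (\<lambda>m. 1 / (real m + 1))
      \<le> 3 * (real k)^2 * (1 / (real (n + 1) * p))"
    using expectation_inverse_binomial[OF p, of n] by (intro mult_left_mono) auto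
  \<comment> \<open>The mean of the pointwise bound is at least 5 / 12 - 3 / 32 = 31 / 96.\<close>
  ultimately have "65 / 256
      \<le> 5 / 12 - 3 * (real k)^2 * measure_pmf.expectation (binomial_pmf n p) (\<lambda>m. 1 / (real m + 1))"
    by simp
  also have "\<dots> = measure_pmf.expectation (binomial_pmf n p)
      (\<lambda>m. 5 / 12 - 3 * (real k)^2 * (1 / (real m + 1)))"
    by (simp add: integrable_measure_pmf_finite[OF fin] del: times_divide_eq_right)
  also have "\<dots> \<le> measure_pmf.expectation (binomial_pmf n p)
      (\<lambda>m. measure_pmf.prob (binomial_pmf m (1/2)) {j. m + k < 2 * j})"
    by (intro integral_mono integrable_measure_pmf_finite[OF fin] ptw)
  finally show ?thesis .
qed

section \<open>The vote of the source labels\<close>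

text \<open>Nested coin flips: the outer one decides whether the observation is informative, the
  inner one whether its label is wrong. For \<open>b = 0\<close> this makes the vote a lazy fair
  random walk. The outcomes are abstract, so that votes are studied without classifiers.\<close>

definition source_pmf :: "real \<Rightarrow> real \<Rightarrow> 'z \<Rightarrow> 'z \<Rightarrow> 'z \<Rightarrow> 'z pmf" where
  "source_pmf p b z0 zg zw = bind_pmf (bernoulli_pmf p)
     (\<lambda>B. if B then map_pmf (\<lambda>c. if c then zw else zg) (bernoulli_pmf ((1 - b) / 2))
          else return_pmf z0)"

lemma set_source_pmf: "set_pmf (source_pmf p b z0 zg zw) \<subseteq> {z0, zg, zw}"
  by (auto simp: source_pmf_def split: if_splits)

lemma finite_source_pmf: "finite (set_pmf (source_pmf p b z0 zg zw))"
  by (rule finite_subset[OF set_source_pmf]) simp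

lemma expectation_source:
  fixes f :: "'z \<Rightarrow> real"
  assumes "0 \<le> p" "p \<le> 1" "0 \<le> b" "b \<le> 1"
  shows "measure_pmf.expectation (source_pmf p b z0 zg zw) f
    = (1 - p) * f z0 + p * ((1 + b) / 2 * f zg + (1 - b) / 2 * f zw)"
proof -
  have fin: "finite (set_pmf (bernoulli_pmf q))" for q by (rule finite_subset[OF subset_UNIV]) simp
  have q: "(1 - b) / 2 \<in> {0..1}" using assms by auto
  have "1 - (1 - b) / 2 = (1 + b) / 2" by (simp add: field_simps)
  then show ?thesis
    unfolding source_pmf_def using assms q
    by (subst expectation_bind_finite) (auto simp: fin field_simps)
qed

text \<open>Here \<open>m\<close> counts the informative observations and \<open>j\<close> those
  among them with the wrong label, so the vote is \<open>j - (m - j)\<close>.\<close>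

lemma sum_votes_fair_source:
  fixes v :: "'z \<Rightarrow> int"
  assumes p: "0 \<le> p" "p \<le> 1" and v: "v z0 = 0" "v zg = -1" "v zw = 1"
  shows "map_pmf (\<lambda>S. \<Sum>z\<leftarrow>S. v z) (replicate_pmf n (source_pmf p 0 z0 zg zw))
    = bind_pmf (binomial_pmf n p)
        (\<lambda>m. map_pmf (\<lambda>j. 2 * int j - int m) (binomial_pmf m (1/2)))"
proof (induction n)
  case 0
  show ?case using p by (simp add: binomial_pmf_0 bind_return_pmf)
next
  case (Suc n)
  let ?F = "\<lambda>m. map_pmf (\<lambda>j. 2 * int j - int m) (binomial_pmf m (1/2))"
  let ?Q = "source_pmf p 0 z0 zg zw" and ?s = "\<lambda>c. if c then 1 else -1 :: int"
  have F_Suc: "?F (Suc m) = bind_pmf (bernoulli_pmf (1/2)) (\<lambda>c. map_pmf (\<lambda>t. ?s c + t) (?F m))" for m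
    by (auto simp: binomial_pmf_Suc map_bind_pmf map_pmf_def bind_assoc_pmf bind_return_pmf
        intro!: bind_pmf_cong)
  have zero: "map_pmf ((+) 0) M = M" for M :: "int pmf"
  proof -
    have "(+) (0::int) = (\<lambda>x. x)" by auto
    then show ?thesis by (simp add: map_pmf_ident)
  qed
  have "map_pmf (\<lambda>S. \<Sum>z\<leftarrow>S. v z) (replicate_pmf (Suc n) ?Q)
      = bind_pmf ?Q (\<lambda>z. map_pmf (\<lambda>t. v z + t) (map_pmf (\<lambda>S. \<Sum>z\<leftarrow>S. v z) (replicate_pmf n ?Q)))"
    by (simp add: map_bind_pmf map_pmf_def bind_assoc_pmf bind_return_pmf)
  also have "\<dots> = bind_pmf (bernoulli_pmf p) (\<lambda>B. if B
      then bind_pmf (bernoulli_pmf (1/2)) (\<lambda>c. map_pmf (\<lambda>t. ?s c + t) (bind_pmf (binomial_pmf n p) ?F))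
      else bind_pmf (binomial_pmf n p) ?F)"
    unfolding Suc.IH
    by (auto simp: source_pmf_def v zero bind_assoc_pmf bind_map_pmf bind_return_pmf intro!: bind_pmf_cong)
  also have "\<dots> = bind_pmf (bernoulli_pmf p) (\<lambda>B. bind_pmf (binomial_pmf n p)
      (\<lambda>m. ?F ((if B then 1 else 0) + m)))"
  proof (intro bind_pmf_cong refl)
    fix B
    \<comment> \<open>The first label is independent of the number of later informative
      observations, so the two draws commute.\<close>
    have "bind_pmf (bernoulli_pmf (1/2)) (\<lambda>c. map_pmf (\<lambda>t. ?s c + t) (bind_pmf (binomial_pmf n p) ?F))
        = bind_pmf (binomial_pmf n p) (\<lambda>m. ?F (Suc m))"
      unfolding F_Suc map_bind_pmf by (rule bind_commute_pmf)
    then show "(if B then bind_pmf (bernoulli_pmf (1/2))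
          (\<lambda>c. map_pmf (\<lambda>t. ?s c + t) (bind_pmf (binomial_pmf n p) ?F))
        else bind_pmf (binomial_pmf n p) ?F)
      = bind_pmf (binomial_pmf n p) (\<lambda>m. ?F ((if B then 1 else 0) + m))"
      by simp
  qed
  also have "\<dots> = bind_pmf (binomial_pmf (Suc n) p) ?F"
    using p by (simp add: binomial_pmf_Suc bind_assoc_pmf bind_return_pmf)
  finally show ?case .
qed

text \<open>
  The two regimes in which \<open>n\<close> source labels, each informative with probability \<open>p\<close>, outvote \<open>k\<close>
  target labels. When the number of informative labels is random, the constant \<open>8\<close> of the
  theorem is too small for the crude estimate, and \<open>p\<close> is chosen four times larger instead.
\<close>

definition swamping :: "real \<Rightarrow> nat \<Rightarrow> nat \<Rightarrow> bool" where
  "swamping p n k \<longleftrightarrow> 1 \<le> k \<and>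
     (p = 1 \<and> 8 * k^2 \<le> n \<or> 0 < p \<and> p \<le> 1 \<and> 32 * (real k)^2 \<le> real n * p)"

text \<open>Conditioning on the number of informative observations reduces the claim to the binomial
  tails above; for \<open>p = 1\<close> that number is \<open>n\<close>.\<close>

lemma fair_source_majority:
  fixes v :: "'z \<Rightarrow> int"
  assumes sw: "swamping p n k" and v: "v z0 = 0" "v zg = -1" "v zw = 1"
  shows "measure_pmf.prob (replicate_pmf n (source_pmf p 0 z0 zg zw)) {S. int k < (\<Sum>z\<leftarrow>S. v z)}
    \<ge> 65 / 256"
proof -
  have p: "0 < p" "p \<le> 1" using sw by (auto simp: swamping_def)
  let ?B = "bind_pmf (binomial_pmf n p)
        (\<lambda>m. map_pmf (\<lambda>j. 2 * int j - int m) (binomial_pmf m (1/2)))"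
  have "measure_pmf.prob (replicate_pmf n (source_pmf p 0 z0 zg zw)) {S. int k < (\<Sum>z\<leftarrow>S. v z)}
      = measure_pmf.prob (map_pmf (\<lambda>S. \<Sum>z\<leftarrow>S. v z) (replicate_pmf n (source_pmf p 0 z0 zg zw))) {t. int k < t}"
    by (simp add: measure_map_pmf vimage_def)
  also have "\<dots> = measure_pmf.expectation ?B (indicator {t. int k < t})"
    using p by (subst sum_votes_fair_source[where v = v, OF _ _ v]) auto
  also have "\<dots> = measure_pmf.expectation (binomial_pmf n p)
      (\<lambda>m. measure_pmf.prob (binomial_pmf m (1/2)) {j. m + k < 2 * j})"
  proof (subst expectation_bind_finite)
    show "finite (set_pmf (binomial_pmf n p))" using p by auto
    show "finite (set_pmf (map_pmf (\<lambda>j. 2 * int j - int m) (binomial_pmf m (1/2))))" for m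
      by auto
    have "measure_pmf.expectation (map_pmf (\<lambda>j. 2 * int j - int m) (binomial_pmf m (1/2)))
        (indicator {t. int k < t}) = measure_pmf.prob (binomial_pmf m (1/2)) {j. m + k < 2 * j}" for m
    proof -
      have "{j. m + k < 2 * j} = (\<lambda>j. 2 * int j - int m) -` {t. int k < t}" by auto
      then show ?thesis by (simp add: measure_map_pmf del: integral_map_pmf)
    qed
    then show "measure_pmf.expectation (binomial_pmf n p)
       (\<lambda>m. measure_pmf.expectation (map_pmf (\<lambda>j. 2 * int j - int m) (binomial_pmf m (1/2)))
          (indicator {t. int k < t}))
     = measure_pmf.expectation (binomial_pmf n p)
        (\<lambda>m. measure_pmf.prob (binomial_pmf m (1/2)) {j. m + k < 2 * j})" by simp
  qed
  also have "\<dots> \<ge> 65 / 256"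
  proof (cases "p = 1 \<and> 8 * k^2 \<le> n")
    case True
    then have "binomial_pmf n p = return_pmf n"
      by (simp add: set_pmf_subset_singleton[symmetric])
    then show ?thesis using fair_deterministic_votes[of k n] True sw by (simp add: swamping_def)
  next
    case False
    then show ?thesis using sw by (intro fair_random_votes) (auto simp: swamping_def)
  qed
  finally show ?thesis .
qed

text \<open>Relative to the fair source the biased one has density \<open>1 - b * v\<close>, with
  second moment \<open>1 + p * b^2\<close>. Since 131072 is \<open>2 * 256^2\<close>, the change of
  measure costs at most 1 / 256, exactly the slack of 65 / 256 over 1 / 4.\<close>

lemma biased_source_majority:
  fixes v :: "'z \<Rightarrow> int"
  assumes sw: "swamping p n k" and v: "v z0 = 0" "v zg = -1" "v zw = 1"
    and b: "0 \<le> b" "b \<le> 1" "real n * p * b^2 \<le> 1 / 131072"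
  shows "measure_pmf.prob (replicate_pmf n (source_pmf p b z0 zg zw)) {S. int k < (\<Sum>z\<leftarrow>S. v z)}
    \<ge> 1 / 4"
proof -
  have p: "0 \<le> p" "p \<le> 1" using sw by (auto simp: swamping_def)
  let ?P = "source_pmf p 0 z0 zg zw" and ?Q = "source_pmf p b z0 zg zw"
  let ?L = "\<lambda>z. 1 - b * real_of_int (v z)" and ?A = "{S. int k < (\<Sum>z\<leftarrow>S. v z)}"
  have dens: "measure_pmf.expectation ?Q f = measure_pmf.expectation ?P (\<lambda>z. ?L z * f z)" for f
    using p b by (simp add: expectation_source v field_simps)
  have "measure_pmf.expectation ?P (\<lambda>z. (?L z)^2) = 1 + p * b^2"
    using p b by (simp add: expectation_source v power2_eq_square field_simps)
  moreover have "(1 + p * b^2) ^ n \<le> 1 + (1 / 256)^2"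
  proof -
    have "(1 + p * b^2) ^ n \<le> exp (p * b^2) ^ n"
      using p by (intro power_mono exp_ge_add_one_self) auto
    also have "\<dots> = exp (real n * p * b^2)" by (simp add: exp_of_nat_mult mult.assoc)
    also have "\<dots> \<le> exp (1 / 131072)" using b by simp
    also have "\<dots> \<le> 1 + (1 / 256)^2"
      using exp_bound[of "1 / 131072"] by (simp add: power2_eq_square)
    finally show ?thesis .
  qed
  ultimately have "sqrt (measure_pmf.expectation ?P (\<lambda>z. (?L z)^2) ^ n - 1) \<le> 1 / 256"
    by (intro real_le_lsqrt) auto
  moreover have "measure_pmf.prob (replicate_pmf n ?P) ?A
      - sqrt (measure_pmf.expectation ?P (\<lambda>z. (?L z)^2) ^ n - 1)
    \<le> measure_pmf.prob (replicate_pmf n ?Q) ?A"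
    by (rule prob_replicate_change_of_measure[OF finite_source_pmf finite_source_pmf dens])
  ultimately show ?thesis using fair_source_majority[where v = v, OF sw v] by linarith
qed

section \<open>Empirical risk minimizers on two points\<close>

text \<open>Where two of three distinct classifiers differ, the third must agree with one of them,
  as there are only two labels; being distinct, these two differ at some other point.\<close>

lemma hypothesis_class_two_points:
  assumes "hypothesis_class H d"
  obtains hs h' x0 x1 where "hs \<in> H" "h' \<in> H" "hs x0 = h' x0" "hs x1 \<noteq> h' x1"
proof -
  have lab: "h x = -1 \<or> h x = 1" if "h \<in> H" for h x
  proof -
    have "h \<in> UNIV \<rightarrow> labels" using assms that unfolding hypothesis_class_def by blast
    then show ?thesis by blast
  qed
  have "\<exists>T\<subseteq>H. card T = 3"
  proof (cases "finite H")
    case True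
    then have "3 \<le> card H" using assms by (simp add: hypothesis_class_def)
    then show ?thesis by (meson obtain_subset_with_card_n)
  next
    case False
    then show ?thesis by (meson infinite_arbitrarily_large)
  qed
  then obtain T where "T \<subseteq> H" "card T = 3" by blast
  then obtain h1 h2 h3 where h: "h1 \<in> H" "h2 \<in> H" "h3 \<in> H" "h1 \<noteq> h2" "h1 \<noteq> h3" "h2 \<noteq> h3"
    unfolding card_3_iff by blast
  obtain x where x: "h1 x \<noteq> h2 x" using h by auto
  have "h3 x = h1 x \<or> h3 x = h2 x"
    using lab[OF h(1), of x] lab[OF h(2), of x] lab[OF h(3), of x] x by linarith
  then show ?thesis
  proof
    assume "h3 x = h1 x"
    moreover obtain y where "h3 y \<noteq> h1 y" using h(5) by (metis ext)
    ultimately show ?thesis using h by (intro that[of h3 h1 x y])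
  next
    assume "h3 x = h2 x"
    moreover obtain y where "h3 y \<noteq> h2 y" using h(6) by (metis ext)
    ultimately show ?thesis using h by (intro that[of h3 h2 x y])
  qed
qed

lemma erm_errors_le:
  assumes "is_erm H S h" "g \<in> H"
  shows "(\<Sum>(x, y)\<leftarrow>S. of_bool (h x \<noteq> y)) \<le> ((\<Sum>(x, y)\<leftarrow>S. of_bool (g x \<noteq> y)) :: real)"
proof (cases "S = []")
  case False
  then show ?thesis
    using assms by (auto simp: is_erm_def is_arg_min_linorder emp_risk_def divide_le_cancel)
qed simp

lemma occurrences_ge_1: "z \<in> set S \<Longrightarrow> (1::real) \<le> (\<Sum>x\<leftarrow>S. of_bool (x = z))"
proof (induction S)
  case (Cons a S)
  have "0 \<le> (\<Sum>x\<leftarrow>S. of_bool (x = z) :: real)" by (intro sum_list_nonneg) auto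
  then show ?case using Cons by auto
qed simp

lemma replicate_return_pmf: "replicate_pmf n (return_pmf z) = return_pmf (replicate n z)"
  by (induction n) (simp_all add: bind_return_pmf)

section \<open>Risks and disagreement as expectations\<close>

lemma risk_eq_expectation:
  "risk P h = measure_pmf.expectation P (\<lambda>(x, y). of_bool (h x \<noteq> y))"
proof -
  have "risk P h = measure_pmf.expectation P (indicator {(x, y). h x \<noteq> y})"
    by (simp add: risk_def)
  also have "indicator {(x, y). h x \<noteq> y} = (\<lambda>(x, y). of_bool (h x \<noteq> y) :: real)"
    by (auto simp: fun_eq_iff indicator_def)
  finally show ?thesis .
qed

lemma disagreement_eq_expectation:
  "disagreement P h g = measure_pmf.expectation P (\<lambda>(x, y). of_bool (h x \<noteq> g x))"
proof -
  have "disagreement P h g = measure_pmf.expectation P (indicator (fst -` {x. h x \<noteq> g x}))"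
    by (simp add: disagreement_def measure_map_pmf)
  also have "indicator (fst -` {x. h x \<noteq> g x}) = (\<lambda>(x, y). of_bool (h x \<noteq> g x) :: real)"
    by (auto simp: fun_eq_iff indicator_def)
  finally show ?thesis .
qed

lemma excess_risk_arg_min:
  assumes "is_arg_min (risk P) (\<lambda>h. h \<in> H) hs"
  shows "excess_risk H P h = risk P h - risk P hs"
proof -
  have "(INF h\<in>H. risk P h) = risk P hs"
    using assms by (intro cInf_eq_minimum) (auto simp: is_arg_min_linorder)
  then show ?thesis by (simp add: excess_risk_def)
qed

lemma le_powr_of_le_1:
  fixes x :: real
  assumes "0 \<le> x" "x \<le> 1" "\<beta> \<le> 1"
  shows "x \<le> x powr \<beta>"
proof (cases "x = 0")
  case False
  then show ?thesis using assms powr_mono'[of \<beta> 1 x] by simp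
qed simp

section \<open>The source and target built on two points\<close>

locale two_point =
  fixes H :: "'x classifier set" and hs h' :: "'x classifier" and x0 x1 :: 'x
  assumes H_labels: "H \<subseteq> UNIV \<rightarrow> labels"
    and hs: "hs \<in> H" and h': "h' \<in> H"
    and agree: "hs x0 = h' x0" and differ: "hs x1 \<noteq> h' x1"
begin

abbreviation "z0 \<equiv> (x0, hs x0)"
abbreviation "zg \<equiv> (x1, hs x1)"
abbreviation "zw \<equiv> (x1, h' x1)"

text \<open>On the support of the source this is the loss of \<open>hs\<close> minus the loss of
  \<open>h'\<close>.\<close>

definition vote :: "'x \<times> int \<Rightarrow> int" where
  "vote z = (if z = zg then -1 else if z = zw then 1 else 0)"

abbreviation "target \<equiv> return_pmf zg"
abbreviation "source p b \<equiv> source_pmf p b z0 zg zw"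

lemma points_distinct: "x0 \<noteq> x1" using agree differ by auto

lemma vote_simps [simp]: "vote z0 = 0" "vote zg = -1" "vote zw = 1"
  using points_distinct differ by (auto simp: vote_def)

lemma label_in: "h \<in> H \<Longrightarrow> h x \<in> labels" using H_labels by blast

lemma value_at_x1: "h \<in> H \<Longrightarrow> h x1 \<noteq> hs x1 \<longleftrightarrow> h x1 = h' x1"
  using label_in[of h x1] label_in[OF hs, of x1] label_in[OF h', of x1] differ by auto

lemma label_distribution_source: "distribution_on_labels (source p b)"
proof -
  have "{z0, zg, zw} \<subseteq> UNIV \<times> labels"
    using label_in[OF hs, of x0] label_in[OF hs, of x1] label_in[OF h', of x1] by blast
  then show ?thesis
    using set_source_pmf[of p b z0 zg zw] unfolding distribution_on_labels_def by (rule subset_trans[rotated])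
qed

lemma label_distribution_target: "distribution_on_labels target"
  using label_in[OF hs, of x1] by (simp add: distribution_on_labels_def)

text \<open>An error at \<open>x0\<close> costs the whole mass \<open>1 - p\<close>, whereas a flip
  at \<open>x1\<close> costs only the difference \<open>p * b\<close> of the masses of the two
  labels.\<close>

lemma risk_source:
  assumes "0 \<le> p" "p \<le> 1" "0 \<le> b" "b \<le> 1" "h \<in> H"
  shows "risk (source p b) h
    = risk (source p b) hs + (1 - p) * of_bool (h x0 \<noteq> hs x0) + p * b * of_bool (h x1 \<noteq> hs x1)"
proof -
  have "h x1 \<noteq> hs x1 \<Longrightarrow> h x1 = h' x1" using value_at_x1[OF \<open>h \<in> H\<close>] by simp
  then show ?thesis
    using assms(1-4) differ
    by (cases "h x1 = hs x1") (simp_all add: risk_eq_expectation expectation_source field_simps)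
qed

lemma arg_min_source:
  assumes "0 \<le> p" "p \<le> 1" "0 \<le> b" "b \<le> 1"
  shows "is_arg_min (risk (source p b)) (\<lambda>h. h \<in> H) hs"
proof -
  have "risk (source p b) hs \<le> risk (source p b) h" if "h \<in> H" for h
    unfolding risk_source[OF assms that] using assms by simp
  then show ?thesis using hs by (simp add: is_arg_min_linorder)
qed

lemma excess_source:
  assumes "0 \<le> p" "p \<le> 1" "0 \<le> b" "b \<le> 1" "h \<in> H"
  shows "excess_risk H (source p b) h
    = (1 - p) * of_bool (h x0 \<noteq> hs x0) + p * b * of_bool (h x1 \<noteq> hs x1)"
  unfolding excess_risk_arg_min[OF arg_min_source[OF assms(1-4)]] risk_source[OF assms] by simp

lemma arg_min_target: "is_arg_min (risk target) (\<lambda>h. h \<in> H) hs"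
  using hs by (simp add: is_arg_min_linorder risk_eq_expectation)

lemma excess_target: "excess_risk H target h = of_bool (h x1 \<noteq> hs x1)"
  by (simp add: excess_risk_arg_min[OF arg_min_target] risk_eq_expectation)

lemma bernstein_target:
  assumes "2 \<le> C" "0 \<le> \<beta>" "\<beta> \<le> 1"
  shows "bernstein_class H target hs C \<beta>"
  using assms arg_min_target
  by (auto simp: bernstein_class_def excess_target disagreement_eq_expectation)

text \<open>The disagreement is \<open>u + p * w\<close> and the excess risk
  \<open>u + p * b * w\<close>. The noiseless part \<open>u\<close> is at most its own power and
  uses one unit of \<open>C\<close>; the noisy part uses the remaining \<open>C - 1\<close>.\<close>

lemma bernstein_source:
  assumes C: "2 \<le> C" and \<beta>: "0 \<le> \<beta>" "\<beta> \<le> 1" and pb: "0 \<le> p" "p \<le> 1" "0 \<le> b" "b \<le> 1"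
    and bern: "\<beta> = 0 \<or> p \<le> (C - 1) * (p * b) powr \<beta>"
  shows "bernstein_class H (source p b) hs C \<beta>"
proof -
  have "disagreement (source p b) h hs
      \<le> C * (if \<beta> = 0 then 1 else excess_risk H (source p b) h powr \<beta>)" if h: "h \<in> H" for h
  proof (cases "\<beta> = 0")
    case True
    have "disagreement (source p b) h hs \<le> 1" by (simp add: disagreement_def)
    then show ?thesis using True C by simp
  next
    case False
    define u w where "u = (1 - p) * of_bool (h x0 \<noteq> hs x0)" and "w = (of_bool (h x1 \<noteq> hs x1) :: real)"
    have w: "w = 0 \<or> w = 1" and u: "0 \<le> u" "u \<le> 1 - p" using pb by (auto simp: u_def w_def)
    have e: "excess_risk H (source p b) h = u + p * b * w"
      using excess_source[OF pb h] by (simp add: u_def w_def)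
    have dis: "disagreement (source p b) h hs = u + p * w"
      using pb by (simp add: disagreement_eq_expectation expectation_source u_def w_def field_simps)
    have pb0: "0 \<le> p * b" using pb by simp
    have "p * b \<le> p" using pb by (simp add: mult_left_le)
    then have u1: "u \<le> 1" using u pb by linarith
    have "u \<le> u powr \<beta>" using u u1 \<beta> by (intro le_powr_of_le_1) auto
    also have "\<dots> \<le> (u + p * b * w) powr \<beta>"
      using u pb0 w \<beta> by (intro powr_mono2) auto
    finally have 1: "u \<le> (u + p * b * w) powr \<beta>" .
    have 2: "p * w \<le> (C - 1) * (u + p * b * w) powr \<beta>"
    proof (cases "w = 0")
      case False
      with w have "w = 1" by simp
      have "(C - 1) * (p * b) powr \<beta> \<le> (C - 1) * (u + p * b) powr \<beta>"
        using u pb0 C \<beta> by (intro mult_left_mono powr_mono2) auto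
      then show ?thesis using bern \<open>\<beta> \<noteq> 0\<close> \<open>w = 1\<close> by simp
    qed (use C in simp)
    from 1 2 show ?thesis using False unfolding e dis by (simp add: algebra_simps)
  qed
  then show ?thesis using assms arg_min_source by (simp add: bernstein_class_def)
qed

text \<open>If \<open>h\<close> were right at \<open>x1\<close>, then \<open>h'\<close> would save
  at least the vote on the source sample and lose only \<open>k\<close> on the target copies,
  against minimality of \<open>h\<close>.\<close>

lemma erm_wrong_on_target:
  assumes erm: "is_erm H (S @ replicate k zg) h" and S: "set S \<subseteq> {z0, zg, zw}"
    and maj: "int k < (\<Sum>z\<leftarrow>S. vote z)"
  shows "h x1 \<noteq> hs x1"
proof
  assume h: "h x1 = hs x1"
  let ?err = "\<lambda>h (x, y). of_bool (h x \<noteq> y) :: real"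
  have "(\<Sum>z\<leftarrow>S. real_of_int (vote z) + ?err h' z) \<le> (\<Sum>z\<leftarrow>S. ?err h z)"
  proof (rule sum_list_mono)
    fix z assume "z \<in> set S"
    then consider "z = z0" | "z = zg" | "z = zw" using S by blast
    then show "real_of_int (vote z) + ?err h' z \<le> ?err h z"
      by cases (use h agree[symmetric] differ in simp_all)
  qed
  moreover have "(\<Sum>z\<leftarrow>S. real_of_int (vote z)) = real_of_int (\<Sum>z\<leftarrow>S. vote z)"
    by (induction S) auto
  ultimately have "real_of_int (\<Sum>z\<leftarrow>S. vote z) + (\<Sum>z\<leftarrow>S. ?err h' z) \<le> (\<Sum>z\<leftarrow>S. ?err h z)"
    by (simp add: sum_list_addf)
  moreover have "(\<Sum>z\<leftarrow>S. ?err h z) \<le> (\<Sum>z\<leftarrow>S. ?err h' z) + real k"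
    using erm_errors_le[OF erm h'] h differ by (simp add: sum_list_replicate)
  ultimately show False using maj by linarith
qed

text \<open>One of \<open>hs\<close> and \<open>h'\<close> has the value of \<open>h\<close> at
  \<open>x1\<close>. It is right at \<open>x0\<close>, so exchanging \<open>h\<close> for it saves
  an error at each occurrence of \<open>z0\<close> and changes nothing at \<open>x1\<close>.\<close>

lemma erm_right_at_x0:
  assumes erm: "is_erm H (S @ replicate k zg) h" and S: "set S \<subseteq> {z0, zg, zw}" "z0 \<in> set S"
  shows "h x0 = hs x0"
proof (rule ccontr)
  assume wrong: "h x0 \<noteq> hs x0"
  have "h \<in> H" using erm by (simp add: is_erm_def is_arg_min_def)
  obtain g where g: "g \<in> H" "g x0 = hs x0" "g x1 = h x1"
    using value_at_x1[OF \<open>h \<in> H\<close>] hs h' agree by metis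
  let ?err = "\<lambda>h (x, y). of_bool (h x \<noteq> y) :: real"
  have "(\<Sum>z\<leftarrow>S. of_bool (z = z0) + ?err g z) \<le> (\<Sum>z\<leftarrow>S. ?err h z)"
  proof (rule sum_list_mono)
    fix z assume "z \<in> set S"
    then consider "z = z0" | "z = zg" | "z = zw" using S by blast
    then show "of_bool (z = z0) + ?err g z \<le> ?err h z"
      by cases (use g wrong points_distinct in simp_all)
  qed
  then have "1 + (\<Sum>z\<leftarrow>S. ?err g z) \<le> (\<Sum>z\<leftarrow>S. ?err h z)"
    using occurrences_ge_1[OF S(2)] by (simp add: sum_list_addf)
  moreover have "(\<Sum>z\<leftarrow>S. ?err h z) \<le> (\<Sum>z\<leftarrow>S. ?err g z)"
    using erm_errors_le[OF erm g(1)] g by (simp add: sum_list_replicate)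
  ultimately show False by simp
qed

section \<open>Expected excess risks of the ERMs\<close>

lemma set_sample_source: "S \<in> set_pmf (replicate_pmf n (source p b)) \<Longrightarrow> set S \<subseteq> {z0, zg, zw}"
  using set_source_pmf[of p b z0 zg zw] by (auto simp: set_replicate_pmf)

lemma integrable_sample_source:
  "integrable (measure_pmf (replicate_pmf n (source p b))) (f :: _ \<Rightarrow> real)"
  by (intro integrable_measure_pmf_finite finite_set_replicate_pmf finite_source_pmf)

text \<open>This covers both learners: \<open>k = 0\<close> is the ERM on the source sample,
  \<open>k = K\<close> the ERM on the union. The excess risk on the target is an indicator, so the
  majority event bounds its mean.\<close>

lemma expected_target_excess_ge:
  assumes sw: "swamping p n K" and b: "0 \<le> b" "b \<le> 1" "real n * p * b^2 \<le> 1 / 131072"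
    and erm: "\<And>S. is_erm H (S @ replicate k zg) (h S)" and k: "k \<le> K"
  shows "measure_pmf.expectation (replicate_pmf n (source p b)) (\<lambda>S. excess_risk H target (h S)) \<ge> 1 / 4"
proof -
  let ?R = "replicate_pmf n (source p b)" and ?A = "{S. int K < (\<Sum>z\<leftarrow>S. vote z)}"
  have "1 / 4 \<le> measure_pmf.prob ?R ?A"
    by (rule biased_source_majority[OF sw _ _ _ b]) simp_all
  also have "\<dots> = measure_pmf.expectation ?R (indicator ?A)" by simp
  also have "\<dots> \<le> measure_pmf.expectation ?R (\<lambda>S. excess_risk H target (h S))"
  proof (intro integral_mono_AE integrable_sample_source AE_pmfI)
    fix S assume "S \<in> set_pmf ?R"
    then have S: "set S \<subseteq> {z0, zg, zw}" by (rule set_sample_source)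
    show "indicator ?A S \<le> excess_risk H target (h S)"
      using erm_wrong_on_target[OF erm S] k by (auto simp: indicator_def excess_target)
  qed
  finally show ?thesis .
qed

text \<open>An error at \<open>x1\<close> costs \<open>p * b\<close>; an error at \<open>x0\<close>
  requires that the sample misses \<open>z0\<close>, which has probability
  \<open>p ^ n\<close>.\<close>

lemma expected_source_excess_le:
  assumes pb: "0 \<le> p" "p \<le> 1" "0 \<le> b" "b \<le> 1"
    and erm: "\<And>S. is_erm H (S @ replicate k zg) (h S)"
  shows "measure_pmf.expectation (replicate_pmf n (source p b)) (\<lambda>S. excess_risk H (source p b) (h S))
    \<le> p * b + (1 - p) * p ^ n"
proof -
  let ?R = "replicate_pmf n (source p b)"
  let ?miss = "\<lambda>S. \<Prod>z\<leftarrow>S. of_bool (z \<noteq> z0) :: real"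
  have miss: "?miss S = of_bool (z0 \<notin> set S)" for S by (induction S) auto
  have "measure_pmf.expectation ?R (\<lambda>S. excess_risk H (source p b) (h S))
      \<le> measure_pmf.expectation ?R (\<lambda>S. p * b + (1 - p) * ?miss S)"
  proof (intro integral_mono_AE integrable_sample_source AE_pmfI)
    fix S assume "S \<in> set_pmf ?R"
    then have S: "set S \<subseteq> {z0, zg, zw}" by (rule set_sample_source)
    have "h S \<in> H" using erm[of S] by (simp add: is_erm_def is_arg_min_def)
    moreover have "0 \<le> p * b" using pb by simp
    ultimately show "excess_risk H (source p b) (h S) \<le> p * b + (1 - p) * ?miss S"
      using erm_right_at_x0[OF erm S] pb by (auto simp: excess_source miss)
  qed
  also have "\<dots> = p * b + (1 - p) * measure_pmf.expectation ?R ?miss"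
    by (simp add: integrable_sample_source)
  also have "measure_pmf.expectation ?R ?miss = p ^ n"
    using pb points_distinct
    by (simp add: expectation_replicate_prod finite_source_pmf expectation_source field_simps)
  finally show ?thesis .
qed

lemma erm_bounds_source_target:
  assumes sw: "swamping p n k" and b: "0 \<le> b" "b \<le> 1" "real n * p * b^2 \<le> 1 / 131072"
    and up: "p * b + (1 - p) * p ^ n \<le> 2 * real n powr (- 1 / (2 - \<beta>))"
  shows "erm_bounds H \<beta> 2 0 (source p b) target n k"
proof -
  have p: "0 \<le> p" "p \<le> 1" and k: "1 \<le> k" using sw by (auto simp: swamping_def)
  \<comment> \<open>With at least one target observation, \<open>hs\<close> makes no error on the
    copies of \<open>zg\<close>, so neither does an ERM.\<close>
  have hD: "excess_risk H target h = 0" if "is_erm H (replicate k zg) h" for h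
    using erm_errors_le[OF that hs] k
    by (cases "h x1 = hs x1") (auto simp: sum_list_replicate excess_target)
  show ?thesis
    unfolding erm_bounds_def Let_def replicate_return_pmf pair_return_pmf2 le_upto_log_def
  proof (intro allI impI, elim conjE, intro conjI)
    fix hP hD' :: "'x dataset \<Rightarrow> 'x classifier" and hZ :: "'x dataset \<times> 'x dataset \<Rightarrow> 'x classifier"
    assume ermP: "\<forall>S. is_erm H S (hP S)" and ermD: "\<forall>S. is_erm H S (hD' S)"
      and ermZ: "\<forall>S T. is_erm H (S @ T) (hZ (S, T))"
    let ?R = "replicate_pmf n (source p b)" and ?T = "replicate k zg"
    have P: "is_erm H (S @ replicate 0 zg) (hP S)" for S using ermP by simp
    have Z: "is_erm H (S @ ?T) (hZ (S, ?T))" for S using ermZ by simp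
    show "1 / 4 \<le> min (measure_pmf.expectation ?R (\<lambda>S. excess_risk H target (hP S)))
        (measure_pmf.expectation (map_pmf (\<lambda>S. (S, ?T)) ?R) (\<lambda>S. excess_risk H target (hZ S)))"
      using expected_target_excess_ge[OF sw b P] expected_target_excess_ge[OF sw b Z] by simp
    show "measure_pmf.expectation (return_pmf ?T) (\<lambda>S. excess_risk H target (hD' S))
        \<le> 2 * (1 + ln (real k)) ^ 0 * real k powr (- 1 / (2 - \<beta>))"
      using hD ermD by simp
    show "max (measure_pmf.expectation ?R (\<lambda>S. excess_risk H (source p b) (hP S)))
        (measure_pmf.expectation (map_pmf (\<lambda>S. (S, ?T)) ?R) (\<lambda>S. excess_risk H (source p b) (hZ S)))
        \<le> 2 * (1 + ln (real n)) ^ 0 * real n powr (- 1 / (2 - \<beta>))"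
      using expected_source_excess_le[OF p b(1,2) P, of n]
        expected_source_excess_le[OF p b(1,2) Z, of n] up by simp
  qed
qed

end

section \<open>Choice of the parameters\<close>

lemma sample_sizes_bound:
  assumes "sample_sizes_ok \<beta> n k" "0 \<le> \<beta>" "\<beta> < 1"
  shows "1 \<le> k" "8 * k^2 \<le> n"
proof -
  have k: "1 \<le> (real k)^2" "8 * (real k)^2 \<le> real n powr ((2 - 2 * \<beta>) / (2 - \<beta>))"
    using assms by (auto simp: sample_sizes_ok_def)
  \<comment> \<open>For \<open>n = 0\<close> the right-hand side would be
    \<open>0 powr _ = 0\<close>.\<close>
  then have "n \<noteq> 0" by (intro notI) simp
  then have "real n powr ((2 - 2 * \<beta>) / (2 - \<beta>)) \<le> real n powr 1"
    using assms by (intro powr_mono) auto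
  then have "8 * (real k)^2 \<le> real n" using k by simp
  then have "real (8 * k^2) \<le> real n" by simp
  then show "8 * k^2 \<le> n" by (simp only: of_nat_le_iff)
  show "1 \<le> k" using k by (cases k) auto
qed

text \<open>Each of the \<open>n\<close> terms of the geometric sum is at least
  \<open>p ^ n\<close>.\<close>

lemma missing_mass_le:
  fixes p :: real
  assumes "0 \<le> p" "p \<le> 1"
  shows "real n * ((1 - p) * p ^ n) \<le> 1"
proof -
  have "real n * p ^ n \<le> (\<Sum>i<n. p ^ i)"
    using sum_bounded_below[of "{..<n}" "p ^ n" "\<lambda>i. p ^ i"] assms by (simp add: power_decreasing)
  then have "(1 - p) * (real n * p ^ n) \<le> (1 - p) * (\<Sum>i<n. p ^ i)"
    using assms by (intro mult_left_mono) auto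
  also have "\<dots> = 1 - p ^ n" by (simp add: one_diff_power_eq)
  also have "\<dots> \<le> 1" using assms by simp
  finally show ?thesis by (simp add: mult_ac)
qed

context two_point
begin

text \<open>The constants fit as follows. The factor 4 in \<open>p\<close> turns the 8 of the sample
  sizes into the 32 of \<open>swamping\<close>. The 400 in \<open>\<epsilon>\<close> gives
  \<open>n * p * b^2 \<le> 1 / 160000\<close>, since \<open>N \<le> p\<close>. As
  \<open>p \<le> 4 * N\<close> and \<open>\<epsilon> powr \<beta> \<ge> N / 400\<close>,
  \<open>C - 1 \<ge> 1600\<close> suffices.\<close>

lemma source_for_sample_size:
  assumes C: "1601 \<le> C" and \<beta>: "0 \<le> \<beta>" "\<beta> < 1"
  shows "\<exists>P. source_target H C \<beta> hs P target \<and>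
    (\<forall>k. sample_sizes_ok \<beta> n k \<longrightarrow> erm_bounds H \<beta> 2 0 P target n k)"
proof (cases "n = 0")
  case True
  \<comment> \<open>Without source observations the bounds are vacuous, and the target itself is an
    admissible source.\<close>
  have "\<not> sample_sizes_ok \<beta> n k" for k using sample_sizes_bound[of \<beta> n k] \<beta> True by auto
  then show ?thesis
    using C \<beta> label_distribution_source label_distribution_target bernstein_target by (auto simp: source_target_def)
next
  case False
  then have n: "1 \<le> real n" by simp
  define r where "r = 1 / (2 - \<beta>)"
  define N where "N = real n powr (- (\<beta> * r))"
  define \<epsilon> where "\<epsilon> = real n powr (- r) / 400"
  define p where "p = min 1 (4 * N)"
  define b where "b = \<epsilon> / p"
  have r: "0 < r" "r \<le> 1" using \<beta> by (auto simp: r_def field_simps)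
  have r2: "1 - \<beta> * r = (2 - 2 * \<beta>) / (2 - \<beta>)" "1 - 2 * r = - (\<beta> * r)" "- 1 / (2 - \<beta>) = - r"
    using \<beta> by (auto simp: r_def field_simps)
  have "0 \<le> \<beta> * r" using \<beta> r by simp
  then have "N \<le> real n powr 0" unfolding N_def using n by (intro powr_mono) auto
  then have N: "0 < N" "N \<le> 1" using n by (auto simp: N_def)
  have nr: "real n powr (- r) \<le> N"
    unfolding N_def using n \<beta> r by (intro powr_mono) (auto intro: mult_left_le_one_le)
  have p: "0 < p" "p \<le> 1" "N \<le> p" using N by (auto simp: p_def)
  have \<epsilon>: "0 < \<epsilon>" "\<epsilon> \<le> p" using n nr p by (auto simp: \<epsilon>_def)
  have b: "0 \<le> b" "b \<le> 1" using \<epsilon> p by (auto simp: b_def)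
  have pb: "p * b = \<epsilon>" using p by (simp add: b_def)
  have "real n * p * b^2 = real n * \<epsilon>^2 / p" using p by (simp add: b_def power2_eq_square)
  \<comment> \<open>The exponent \<open>r\<close> satisfies
    \<open>1 - 2 * r = - (\<beta> * r)\<close>.\<close>
  also have "real n * \<epsilon>^2 = N / 160000"
  proof -
    have "real n * (real n powr (- r))^2 = real n powr 1 * (real n powr (- r) * real n powr (- r))"
      using n by (simp add: power2_eq_square)
    also have "\<dots> = real n powr (1 - 2 * r)" by (simp only: flip: powr_add) simp
    finally show ?thesis by (simp add: \<epsilon>_def N_def r2 power_divide)
  qed
  also have "N / 160000 / p \<le> 1 / 131072" using p by (simp add: field_simps)
  finally have chi: "real n * p * b^2 \<le> 1 / 131072" .
  have "bernstein_class H (source p b) hs C \<beta>"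
  proof (rule bernstein_source)
    have "p \<le> 4 * N" by (simp add: p_def)
    also have "\<dots> \<le> 1600 * ((1 / 400) powr \<beta> * N)"
    proof -
      have "1 / 400 \<le> (1 / 400 :: real) powr \<beta>" using \<beta> by (intro le_powr_of_le_1) auto
      then show ?thesis using N by simp
    qed
    also have "(1 / 400) powr \<beta> * N = \<epsilon> powr \<beta>"
      by (simp add: \<epsilon>_def N_def powr_divide powr_powr mult.commute)
    also have "1600 * \<epsilon> powr \<beta> \<le> (C - 1) * \<epsilon> powr \<beta>" using C by (intro mult_right_mono) auto
    finally show "\<beta> = 0 \<or> p \<le> (C - 1) * (p * b) powr \<beta>" by (simp add: pb)
  qed (use C \<beta> p b in auto)
  then have "source_target H C \<beta> hs (source p b) target"
    using C \<beta> label_distribution_source label_distribution_target bernstein_target by (simp add: source_target_def)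
  moreover have "erm_bounds H \<beta> 2 0 (source p b) target n k" if ok: "sample_sizes_ok \<beta> n k" for k
  proof (rule erm_bounds_source_target[OF _ b chi])
    note k = sample_sizes_bound[OF ok \<beta>]
    show "swamping p n k"
    proof (cases "p = 1")
      case True
      then show ?thesis using k by (simp add: swamping_def)
    next
      case False
      then have "p = 4 * N" by (simp add: p_def min_def split: if_splits)
      moreover have "real n * N = real n powr (1 - \<beta> * r)"
        using n by (simp add: N_def powr_diff powr_minus_divide)
      ultimately have "real n * p = 4 * real n powr ((2 - 2 * \<beta>) / (2 - \<beta>))"
        by (simp add: r2)
      moreover have "8 * (real k)^2 \<le> real n powr ((2 - 2 * \<beta>) / (2 - \<beta>))"
        using ok by (simp add: sample_sizes_ok_def)
      ultimately show ?thesis using k p by (simp add: swamping_def)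
    qed
    have "(1 - p) * p ^ n \<le> 1 / real n"
      using missing_mass_le[of p n] p n by (simp add: field_simps)
    also have "\<dots> = real n powr (- 1)" using n by (simp add: powr_minus_divide)
    also have "\<dots> \<le> real n powr (- r)" using n r by (intro powr_mono) auto
    finally have "(1 - p) * p ^ n \<le> real n powr (- r)" .
    moreover have "\<epsilon> \<le> real n powr (- r)" by (simp add: \<epsilon>_def)
    ultimately show "p * b + (1 - p) * p ^ n \<le> 2 * real n powr (- 1 / (2 - \<beta>))"
      unfolding pb r2 by linarith
  qed
  ultimately show ?thesis by blast
qed

text \<open>With \<open>p = 1\<close> and \<open>b = 0\<close> the labels at \<open>x1\<close> are
  pure noise: every classifier in \<open>H\<close> has source excess risk 0, and the same source
  serves all sample sizes.\<close>

lemma unbiased_source: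
  assumes "2 \<le> C"
  shows "source_target H C 0 hs (source 1 0) target"
    "sample_sizes_ok 0 n k \<Longrightarrow> erm_bounds H 0 2 0 (source 1 0) target n k"
proof -
  show "source_target H C 0 hs (source 1 0) target"
    using assms label_distribution_source label_distribution_target bernstein_target bernstein_source[of C 0 1 0]
    by (simp add: source_target_def)
  assume "sample_sizes_ok 0 n k"
  from sample_sizes_bound[OF this]
  show "erm_bounds H 0 2 0 (source 1 0) target n k"
    by (intro erm_bounds_source_target) (auto simp: swamping_def)
qed

end

lemma hypothesis_class_two_point:
  assumes "hypothesis_class H d"
  obtains hs h' x0 x1 where "two_point H hs h' x0 x1"
proof -
  obtain hs h' x0 x1 where "hs \<in> H" "h' \<in> H" "hs x0 = h' x0" "hs x1 \<noteq> h' x1"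
    using hypothesis_class_two_points[OF assms] .
  then show ?thesis
    using assms by (intro that[of hs h' x0 x1]) (auto simp: two_point_def hypothesis_class_def)
qed

(* First conjunct: one pair of distributions for all sample sizes, for some beta.
   Second conjunct: every beta in [0,1), with a source that may depend on nP. For beta > 0 and
   finite H no fixed pair can work; and for beta near 1 the constant 1/4 requires C
   larger than 2. *)
theorem theorem2:
  shows
  "(\<forall>C\<ge>2. \<forall>d. \<exists>K>0. \<exists>k. \<forall>H :: 'x classifier set. hypothesis_class H d \<longrightarrow>
      (\<exists>\<beta>. 0 \<le> \<beta> \<and> \<beta> < 1 \<and>
        (\<exists>hs P D. source_target H C \<beta> hs P D \<and>
          (\<forall>nP nD. sample_sizes_ok \<beta> nP nD \<longrightarrow> erm_bounds H \<beta> K k P D nP nD))))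
   \<and>
   (\<exists>C\<^sub>0\<ge>2. \<forall>C\<ge>C\<^sub>0. \<forall>d. \<exists>K>0. \<exists>k. \<forall>H :: 'x classifier set. hypothesis_class H d \<longrightarrow>
      (\<forall>\<beta>. 0 \<le> \<beta> \<and> \<beta> < 1 \<longrightarrow>
        (\<exists>hs D. \<forall>nP. \<exists>P. source_target H C \<beta> hs P D \<and>
          (\<forall>nD. sample_sizes_ok \<beta> nP nD \<longrightarrow> erm_bounds H \<beta> K k P D nP nD))))"
proof (rule conjI)
  have fixed: "\<exists>hs P D. source_target H C 0 hs P D \<and>
      (\<forall>nP nD. sample_sizes_ok 0 nP nD \<longrightarrow> erm_bounds H 0 2 0 P D nP nD)"
    if C: "2 \<le> C" and hyp: "hypothesis_class H d" for C d and H :: "'x classifier set"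
  proof -
    obtain hs h' x0 x1 where "two_point H hs h' x0 x1"
      using hypothesis_class_two_point[OF hyp] .
    then interpret two_point H hs h' x0 x1 .
    show ?thesis using unbiased_source[OF C] by blast
  qed
  \<comment> \<open>The mass and the bias at \<open>x1\<close> are tuned to \<open>nP\<close>, so
    \<open>P\<close> is chosen after \<open>nP\<close>; \<open>hs\<close> and the target stay
    fixed.\<close>
  have varying: "\<exists>hs D. \<forall>nP. \<exists>P. source_target H C \<beta> hs P D \<and>
      (\<forall>nD. sample_sizes_ok \<beta> nP nD \<longrightarrow> erm_bounds H \<beta> 2 0 P D nP nD)"
    if C: "1601 \<le> C" and hyp: "hypothesis_class H d" and \<beta>: "0 \<le> \<beta>" "\<beta> < 1" for C \<beta> d and H :: "'x classifier set"
  proof -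
    obtain hs h' x0 x1 where "two_point H hs h' x0 x1"
      using hypothesis_class_two_point[OF hyp] .
    then interpret two_point H hs h' x0 x1 .
    show ?thesis using source_for_sample_size[OF C \<beta>] by blast
  qed
  show "\<forall>C\<ge>2. \<forall>d. \<exists>K>0. \<exists>k. \<forall>H :: 'x classifier set. hypothesis_class H d \<longrightarrow>
      (\<exists>\<beta>. 0 \<le> \<beta> \<and> \<beta> < 1 \<and>
        (\<exists>hs P D. source_target H C \<beta> hs P D \<and>
          (\<forall>nP nD. sample_sizes_ok \<beta> nP nD \<longrightarrow> erm_bounds H \<beta> K k P D nP nD)))"
    by (intro allI impI exI[of _ "2 :: real"] exI[of _ "0 :: nat"] exI[of _ "0 :: real"] conjI fixed)
       auto
  show "\<exists>C\<^sub>0\<ge>2. \<forall>C\<ge>C\<^sub>0. \<forall>d. \<exists>K>0. \<exists>k. \<forall>H :: 'x classifier set. hypothesis_class H d \<longrightarrow>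
      (\<forall>\<beta>. 0 \<le> \<beta> \<and> \<beta> < 1 \<longrightarrow>
        (\<exists>hs D. \<forall>nP. \<exists>P. source_target H C \<beta> hs P D \<and>
          (\<forall>nD. sample_sizes_ok \<beta> nP nD \<longrightarrow> erm_bounds H \<beta> K k P D nP nD)))"
  proof (rule exI[of _ "1601 :: real"], intro conjI allI impI)
    fix C :: real and d
    assume C: "1601 \<le> C"
    show "\<exists>K>0. \<exists>k. \<forall>H :: 'x classifier set. hypothesis_class H d \<longrightarrow>
      (\<forall>\<beta>. 0 \<le> \<beta> \<and> \<beta> < 1 \<longrightarrow>
        (\<exists>hs D. \<forall>nP. \<exists>P. source_target H C \<beta> hs P D \<and>
          (\<forall>nD. sample_sizes_ok \<beta> nP nD \<longrightarrow> erm_bounds H \<beta> K k P D nP nD)))"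
      using varying[OF C] by (intro exI[of _ "2 :: real"] conjI exI[of _ "0 :: nat"]) auto
  qed simp
qed

end
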